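(* Let $\mathscr{A}$ be a closed set of impartial games whose misère quotient $(\mathcal{Q},\mathcal{P})$ is finite and regular, and whose quotient map $\Phi:\mathscr{A}\to\mathcal{Q}$ is faithful. Let $\mathcal{K}$ be the kernel of $\mathcal{Q}$ and let $z$ be the identity of $\mathcal{K}$. Then for all $G,H\in\mathscr{A}$, \[z\Phi(G)=z\Phi(H)\iff G \text{ and } H \text{ have the same normal-play Grundy value}.\]
   Context: All games are impartial; $G+H$ denotes the disjunctive sum. In misère play the player who makes the last move loses; $o^-(G)\in\{\mathscr{P},\mathscr{N}\}$ denotes the misère outcome ($\mathscr{P}$ if the player not to move can force a win, $\mathscr{N}$ otherwise). A set $\mathscr{A}$ of games is closed if it is closed under disjunctive sum and every option of a member of $\mathscr{A}$ is in $\mathscr{A}$. For closed $\mathscr{A}$ and $G,H\in\mathscr{A}$ write $G\equiv_{\mathscr{A}}H$ iff $o^-(G+X)=o^-(H+X)$ for every $X\in\mathscr{A}$; this is a congruence, $\mathcal{Q}=\mathscr{A}/\equiv_{\mathscr{A}}$ is a commutative monoid, $\Phi:\mathscr{A}\to\mathcal{Q}$ is the quotient map, and $\mathcal{P}=\{\Phi(G):G\in\mathscr{A},\ o^-(G)=\mathscr{P}\}$. The pair $(\mathcal{Q},\mathcal{P})$ is the misère quotient of $\mathscr{A}$. For a finite commutative monoid $\mathcal{Q}$: $x$ divides $y$ if $xw=y$ for some $w\in\mathcal{Q}$; $z$ is the product of all idempotents ($e^2=e$) of $\mathcal{Q}$, and the kernel $\mathcal{K}$ is the set of $x\in\mathcal{Q}$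 with $x\mid z$ and $z\mid x$; it is a group with identity $z$. The finite quotient $(\mathcal{Q},\mathcal{P})$ is regular if $|\mathcal{K}\cap\mathcal{P}|=1$. The quotient map $\Phi$ is faithful if $\Phi(G)=\Phi(H)$ implies that $G$ and $H$ have the same normal-play (Sprague–Grundy) value. *)

theory Defs
  imports "HOL-Library.FSet" "HOL-Algebra.Divisibility" "HOL-Algebra.FiniteProduct"
begin

section \<open>Impartial games\<close>

text \<open>A (finite, loop-free) impartial game is identified with the finite set of its options.\<close>

datatype game = Game (options: "game fset")

lemma size_option:
  assumes "G' |\<in>| options G"
  shows "size G' < size G"
proof (cases G)
  case (Game S)
  then have "Suc (size G') \<le> (\<Sum>x\<in>fset S. Suc (size x))"
    using assms by (intro member_le_sum) auto
  then show ?thesis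
    using Game by (simp add: size_fset_overloaded_simps)
qed

instantiation game :: comm_monoid_add
begin

definition zero_game :: game where "0 = Game {||}"

function plus_game :: "game \<Rightarrow> game \<Rightarrow> game" where
  "G + H = Game ((\<lambda>G'. G' + H) |`| options G |\<union>| (\<lambda>H'. G + H') |`| options H)"
  by auto
termination
  by (relation "measure (\<lambda>(G, H). size G + size H)") (auto dest: size_option)

declare plus_game.simps [simp del]

lemma options_plus:
  "options (G + H) = (\<lambda>G'. G' + H) |`| options G |\<union>| (\<lambda>H'. G + H') |`| options H"
  by (subst plus_game.simps) simp

instance
proof
  fix G H K :: game
  show "G + H + K = G + (H + K)"
  proof (induction "size G + size H + size K" arbitrary: G H K rule: less_induct)
    case less
    have "options (G + H + K) = options (G + (H + K))"
      unfolding options_plus fimage_funion fset.map_comp funion_assoc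
      by (intro arg_cong2[where f = "(|\<union>|)"] fset.map_cong0) (auto simp: less size_option)
    then show ?case by (rule game.expand)
  qed
  show "G + H = H + G"
  proof (induction "size G + size H" arbitrary: G H rule: less_induct)
    case less
    have "(\<lambda>G'. G' + H) |`| options G = (\<lambda>G'. H + G') |`| options G"
      by (intro fset.map_cong0 less) (simp add: size_option)
    moreover have "(\<lambda>H'. G + H') |`| options H = (\<lambda>H'. H' + G) |`| options H"
      by (intro fset.map_cong0 less) (simp add: size_option)
    ultimately have "options (G + H) = options (H + G)"
      by (simp add: options_plus funion_commute)
    then show ?case by (rule game.expand)
  qed
  show "0 + G = G"
  proof (induction "size G" arbitrary: G rule: less_induct)
    case less
    have "(\<lambda>G'. 0 + G') |`| options G = id |`| options G"
      by (intro fset.map_cong0) (auto simp: less size_option)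
    then have "options (0 + G) = options G"
      by (subst options_plus) (simp add: zero_game_def)
    then show ?case by (rule game.expand)
  qed
qed

end

text \<open>The normal-play Grundy value: the minimal excludant of the values of the options.\<close>

primrec grundy :: "game \<Rightarrow> nat" where
  "grundy (Game S) = (LEAST n. n |\<notin>| grundy |`| S)"

datatype outcome = P_outcome | N_outcome

text \<open>In misere play a player who has no move wins, so the game without options has outcome N.\<close>

primrec misere_outcome :: "game \<Rightarrow> outcome" where
  "misere_outcome (Game S) =
     (if S = {||} \<or> P_outcome |\<in>| misere_outcome |`| S then N_outcome else P_outcome)"

definition closed_games :: "game set \<Rightarrow> bool" where
  "closed_games A \<longleftrightarrow>
     (\<forall>G\<in>A. \<forall>H\<in>A. G + H \<in> A) \<and> (\<forall>G\<in>A. \<forall>G'. G' |\<in>| options G \<longrightarrow> G' \<in> A)"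


section \<open>Misere quotients\<close>

definition misere_equiv :: "game set \<Rightarrow> (game \<times> game) set" where
  "misere_equiv A = {(G, H). G \<in> A \<and> H \<in> A \<and>
     (\<forall>X\<in>A. misere_outcome (G + X) = misere_outcome (H + X))}"

definition quotient_map :: "game set \<Rightarrow> game \<Rightarrow> game set" where
  "quotient_map A G = misere_equiv A `` {G}"

text \<open>In the multiplication below, all classes in the union coincide when \<open>A\<close> is closed,
  since \<^term>\<open>misere_equiv A\<close> is then a congruence.\<close>

definition quotient_monoid :: "game set \<Rightarrow> game set monoid" where
  "quotient_monoid A =
     \<lparr>carrier = A // misere_equiv A,
      mult = (\<lambda>x y. \<Union>G\<in>x. \<Union>H\<in>y. quotient_map A (G + H)),
      one = quotient_map A 0\<rparr>"

definition P_portion :: "game set \<Rightarrow> game set set" where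
  "P_portion A = quotient_map A ` {G \<in> A. misere_outcome G = P_outcome}"

definition faithful :: "game set \<Rightarrow> bool" where
  "faithful A \<longleftrightarrow>
     (\<forall>G\<in>A. \<forall>H\<in>A. quotient_map A G = quotient_map A H \<longrightarrow> grundy G = grundy H)"


section \<open>The kernel of a finite commutative monoid\<close>

definition idempotents :: "('a, 'b) monoid_scheme \<Rightarrow> 'a set" where
  "idempotents M = {e \<in> carrier M. e \<otimes>\<^bsub>M\<^esub> e = e}"

definition idempotent_product :: "('a, 'b) monoid_scheme \<Rightarrow> 'a" where
  "idempotent_product M = (\<Otimes>\<^bsub>M\<^esub>e\<in>idempotents M. e)"

definition monoid_kernel :: "('a, 'b) monoid_scheme \<Rightarrow> 'a set" where
  "monoid_kernel M = {x \<in> carrier M.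
     x divides\<^bsub>M\<^esub> idempotent_product M \<and> idempotent_product M divides\<^bsub>M\<^esub> x}"

definition is_identity_of :: "('a, 'b) monoid_scheme \<Rightarrow> 'a set \<Rightarrow> 'a \<Rightarrow> bool" where
  "is_identity_of M K z \<longleftrightarrow> z \<in> K \<and> (\<forall>x\<in>K. z \<otimes>\<^bsub>M\<^esub> x = x \<and> x \<otimes>\<^bsub>M\<^esub> z = x)"

definition regular_quotient :: "game set \<Rightarrow> bool" where
  "regular_quotient A \<longleftrightarrow> card (monoid_kernel (quotient_monoid A) \<inter> P_portion A) = 1"


section \<open>Well-definedness\<close>

lemma equiv_misere_equiv: "equiv A (misere_equiv A)"
  by (auto simp: equiv_def refl_on_def sym_def trans_def misere_equiv_def)

lemma quotient_map_eq_iff: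
  "G \<in> A \<Longrightarrow> H \<in> A \<Longrightarrow>
     quotient_map A G = quotient_map A H \<longleftrightarrow>
     (\<forall>X\<in>A. misere_outcome (G + X) = misere_outcome (H + X))"
  unfolding quotient_map_def
  by (subst eq_equiv_class_iff[OF equiv_misere_equiv]) (auto simp: misere_equiv_def)

lemma misere_equiv_plus:
  assumes "closed_games A" "(G, G') \<in> misere_equiv A" "(H, H') \<in> misere_equiv A"
  shows "(G + H, G' + H') \<in> misere_equiv A"
proof -
  have *: "G \<in> A" "G' \<in> A" "H \<in> A" "H' \<in> A" using assms by (auto simp: misere_equiv_def)
  have "misere_outcome (G + H + X) = misere_outcome (G' + H' + X)" if "X \<in> A" for X
  proof -
    have "misere_outcome (G + (H + X)) = misere_outcome (G' + (H + X))"
      using assms that * by (auto simp: misere_equiv_def closed_games_def)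
    also have "\<dots> = misere_outcome (H + (G' + X))" by (simp add: add.left_commute)
    also have "\<dots> = misere_outcome (H' + (G' + X))"
      using assms that * by (auto simp: misere_equiv_def closed_games_def)
    finally show ?thesis by (simp add: ac_simps)
  qed
  then show ?thesis using assms(1) * by (auto simp: misere_equiv_def closed_games_def)
qed

lemma quotient_map_plus:
  assumes "closed_games A" "G \<in> A" "H \<in> A"
  shows "quotient_map A G \<otimes>\<^bsub>quotient_monoid A\<^esub> quotient_map A H = quotient_map A (G + H)"
proof -
  have eq: "quotient_map A (G' + H') = quotient_map A (G + H)"
    if "G' \<in> quotient_map A G" "H' \<in> quotient_map A H" for G' H'
  proof -
    have "(G + H, G' + H') \<in> misere_equiv A"
      using misere_equiv_plus assms(1) that by (auto simp: quotient_map_def)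
    then show ?thesis
      unfolding quotient_map_def by (metis equiv_class_eq equiv_misere_equiv)
  qed
  have "G \<in> quotient_map A G" "H \<in> quotient_map A H"
    using assms by (auto simp: quotient_map_def misere_equiv_def)
  then have "(\<Union>G'\<in>quotient_map A G. \<Union>H'\<in>quotient_map A H. quotient_map A (G' + H'))
      = quotient_map A (G + H)"
    using eq by blast
  then show ?thesis by (simp add: quotient_monoid_def)
qed

lemma zero_in_closed_games:
  assumes "closed_games A" "G \<in> A"
  shows "0 \<in> A"
  using assms(2)
proof (induction G)
  case (Game S)
  show ?case
  proof (cases "S = {||}")
    case True
    then show ?thesis using Game by (simp add: zero_game_def)
  next
    case False
    then obtain G' where "G' |\<in>| S" by auto
    then show ?thesis using Game assms(1) by (force simp: closed_games_def)
  qed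
qed

lemma comm_monoid_quotient_monoid:
  assumes "closed_games A" "A \<noteq> {}"
  shows "comm_monoid (quotient_monoid A)"
proof -
  have 0: "0 \<in> A" using assms zero_in_closed_games by blast
  have carrier: "carrier (quotient_monoid A) = quotient_map A ` A"
    by (auto simp: quotient_monoid_def quotient_def quotient_map_def)
  have quotient_map_in_carrier: "quotient_map A G \<in> carrier (quotient_monoid A)" if "G \<in> A" for G
    using that by (simp add: carrier)
  have one: "\<one>\<^bsub>quotient_monoid A\<^esub> = quotient_map A 0"
    by (simp add: quotient_monoid_def)
  have plus: "G + H \<in> A" if "G \<in> A" "H \<in> A" for G H
    using assms(1) that by (auto simp: closed_games_def)
  note simps = one 0 plus quotient_map_plus[OF assms(1)] quotient_map_in_carrier
  show ?thesis
  proof (rule comm_monoidI)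
    fix x y z
    assume "x \<in> carrier (quotient_monoid A)" "y \<in> carrier (quotient_monoid A)"
      "z \<in> carrier (quotient_monoid A)"
    then obtain G H K where "G \<in> A" "H \<in> A" "K \<in> A"
      "x = quotient_map A G" "y = quotient_map A H" "z = quotient_map A K"
      by (auto simp: carrier)
    then show "x \<otimes>\<^bsub>quotient_monoid A\<^esub> y \<otimes>\<^bsub>quotient_monoid A\<^esub> z =
        x \<otimes>\<^bsub>quotient_monoid A\<^esub> (y \<otimes>\<^bsub>quotient_monoid A\<^esub> z)"
      by (simp add: simps add.assoc)
  next
    fix x y
    assume "x \<in> carrier (quotient_monoid A)" "y \<in> carrier (quotient_monoid A)"
    then obtain G H where *: "G \<in> A" "H \<in> A" "x = quotient_map A G" "y = quotient_map A H"
      by (auto simp: carrier)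
    then show "x \<otimes>\<^bsub>quotient_monoid A\<^esub> y = y \<otimes>\<^bsub>quotient_monoid A\<^esub> x"
      by (simp add: simps add.commute)
    show "x \<otimes>\<^bsub>quotient_monoid A\<^esub> y \<in> carrier (quotient_monoid A)"
      using * by (simp add: simps)
  next
    fix x assume "x \<in> carrier (quotient_monoid A)"
    then obtain G where "G \<in> A" "x = quotient_map A G"
      by (auto simp: carrier)
    then show "\<one>\<^bsub>quotient_monoid A\<^esub> \<otimes>\<^bsub>quotient_monoid A\<^esub> x = x"
      by (simp add: simps)
  qed (simp add: simps)
qed

lemma is_identity_of_idempotent_product:
  assumes "comm_monoid M" "finite (carrier M)"
  shows "is_identity_of M (monoid_kernel M) (idempotent_product M)"
proof -
  interpret comm_monoid M by fact
  define z where "z = idempotent_product M"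
  have z: "z \<in> carrier M"
    unfolding z_def idempotent_product_def
    by (rule finprod_closed) (auto simp: idempotents_def)
  have "z \<otimes>\<^bsub>M\<^esub> z = (\<Otimes>\<^bsub>M\<^esub>e\<in>idempotents M. e \<otimes>\<^bsub>M\<^esub> e)"
    unfolding z_def idempotent_product_def
    by (rule finprod_multf[symmetric]) (auto simp: idempotents_def)
  also have "\<dots> = z"
    unfolding z_def idempotent_product_def
    by (rule finprod_cong') (auto simp: idempotents_def)
  finally have idem: "z \<otimes>\<^bsub>M\<^esub> z = z" .
  have "z \<otimes>\<^bsub>M\<^esub> x = x" if x: "x \<in> monoid_kernel M" for x
  proof -
    obtain w where "w \<in> carrier M" "x = z \<otimes>\<^bsub>M\<^esub> w"
      using x by (auto simp: monoid_kernel_def factor_def z_def)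
    then show ?thesis using z idem by (simp flip: m_assoc)
  qed
  moreover have "z \<in> monoid_kernel M"
    using z by (auto simp: monoid_kernel_def simp flip: z_def)
  moreover have "x \<in> carrier M" if "x \<in> monoid_kernel M" for x
    using that by (simp add: monoid_kernel_def)
  ultimately show ?thesis
    using z by (simp add: is_identity_of_def m_comm flip: z_def)
qed

end

theory Submission
  imports Defs
begin

text \<open>
  Faithfulness makes the Grundy value a well-defined, cancellative function on the quotient
  \<open>Q\<close>, which gives the forward implication. For the converse, let \<open>p\<close> be the only element of
  \<open>K \<inter> P\<close>, where \<open>K\<close> is the kernel. Every \<open>x \<in> K\<close> is represented by a game all of whose options
  map into the ideal \<open>K\<close>. If \<open>x \<noteq> p\<close>, that game is an N-position, so one of its options is a
  P-position and hence maps to \<open>p\<close>; as a game and its option have different Grundy values, \<open>x\<close>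
  and \<open>p\<close> have different Grundy values. Translating in the group \<open>K\<close>, the Grundy value is
  injective on \<open>K\<close>.
\<close>

section \<open>Grundy values of sums\<close>

lemma grundy_eq_Least: "grundy G = (LEAST n. n |\<notin>| grundy |`| options G)"
  by (cases G) simp

lemma grundy_option_neq:
  assumes "G' |\<in>| options G"
  shows "grundy G' \<noteq> grundy G"
proof -
  obtain n where "n |\<notin>| grundy |`| options G"
    using ex_new_if_finite[OF infinite_UNIV_nat finite_fset] by blast
  then have "grundy G |\<notin>| grundy |`| options G"
    unfolding grundy_eq_Least[of G] by (rule LeastI)
  then show ?thesis using assms by (metis fimageI)
qed

lemma ex_option_grundy_eq:
  assumes "n < grundy G"
  obtains G' where "G' |\<in>| options G" "grundy G' = n"
proof -
  have "n |\<in>| grundy |`| options G"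
    using assms not_less_Least unfolding grundy_eq_Least[of G] by blast
  then show ?thesis using that by auto
qed

lemma grundy_eq_0_iff: "grundy G = 0 \<longleftrightarrow> (\<forall>G'. G' |\<in>| options G \<longrightarrow> grundy G' \<noteq> 0)"
  by (metis ex_option_grundy_eq grundy_option_neq gr0I)

lemma option_plus_iff:
  "X |\<in>| options (G + H) \<longleftrightarrow>
     (\<exists>G'. G' |\<in>| options G \<and> X = G' + H) \<or> (\<exists>H'. H' |\<in>| options H \<and> X = G + H')"
  by (auto simp: options_plus)

text \<open>By induction, the options of value 0 are those whose two summands have equal values.
  From equal values every move breaks equality; from unequal ones the larger can be lowered to the
  smaller.\<close>

lemma grundy_plus_eq_0_iff: "grundy (G + H) = 0 \<longleftrightarrow> grundy G = grundy H"
proof (induction "size G + size H" arbitrary: G H rule: less_induct)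
  case less
  have left: "grundy (G' + H) = 0 \<longleftrightarrow> grundy G' = grundy H" if "G' |\<in>| options G" for G'
    using that by (intro less) (simp add: size_option)
  have right: "grundy (G + H') = 0 \<longleftrightarrow> grundy G = grundy H'" if "H' |\<in>| options H" for H'
    using that by (intro less) (simp add: size_option)
  have "grundy (G + H) = 0 \<longleftrightarrow>
      (\<forall>G'. G' |\<in>| options G \<longrightarrow> grundy G' \<noteq> grundy H) \<and>
      (\<forall>H'. H' |\<in>| options H \<longrightarrow> grundy G \<noteq> grundy H')"
    unfolding grundy_eq_0_iff[of "G + H"] option_plus_iff using left right by blast
  also have "\<dots> \<longleftrightarrow> grundy G = grundy H"
    by (metis ex_option_grundy_eq grundy_option_neq linorder_neqE_nat)
  finally show ?case .
qed

text \<open>Equality of values means that the sum has value 0; regrouping isolates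
  \<open>X + X\<close>, which has value 0.\<close>

lemma grundy_plus_left_cancel: "grundy (X + G) = grundy (X + H) \<longleftrightarrow> grundy G = grundy H"
proof -
  have "grundy (X + G) = grundy (X + H) \<longleftrightarrow> grundy (X + X + (G + H)) = 0"
    by (simp add: grundy_plus_eq_0_iff[symmetric] ac_simps)
  also have "\<dots> \<longleftrightarrow> grundy (X + X) = grundy (G + H)"
    by (rule grundy_plus_eq_0_iff)
  also have "\<dots> \<longleftrightarrow> grundy G = grundy H"
    using grundy_plus_eq_0_iff[of X X] grundy_plus_eq_0_iff[of G H] by auto
  finally show ?thesis .
qed

section \<open>The kernel of a finite commutative monoid\<close>

context comm_monoid
begin

text \<open>By pigeonhole the powers of \<open>x\<close> are periodic from some exponent
  \<open>i\<close> on, with a period \<open>d\<close>.\<close>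

lemma ex_idempotent_pow:
  assumes "finite (carrier G)" "x \<in> carrier G"
  obtains n :: nat where "0 < n" "x [^] n \<in> idempotents G"
proof -
  have "\<not> inj (\<lambda>n::nat. x [^] n)"
    using finite_subset[of "range (\<lambda>n::nat. x [^] n)", OF _ assms(1)] assms(2)
    by (auto dest: finite_imageD)
  then obtain i d :: nat where d: "0 < d" and period: "x [^] (i + d) = x [^] i"
    unfolding inj_def by (metis less_imp_add_positive linorder_neqE_nat)
  have shift: "x [^] (n + d) = x [^] n" if "i \<le> n" for n
  proof -
    have "x [^] (n + d) = x [^] (i + d) \<otimes> x [^] (n - i)"
      using that assms(2) by (simp add: nat_pow_mult add.commute)
    then show ?thesis using that assms(2) by (simp add: period nat_pow_mult)
  qed
  have shifts: "x [^] (n + k * d) = x [^] n" if "i \<le> n" for n k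
  proof (induction k)
    case (Suc k)
    then show ?case using that shift[of "n + k * d"] by (simp add: ac_simps)
  qed simp
  \<comment> \<open>A multiple of the period that is at least \<open>i\<close>, so doubling it does
    not change the power; \<open>Suc\<close> keeps it positive when \<open>i = 0\<close>.\<close>
  define n where "n = Suc i * d"
  have "i \<le> n" using d by (simp add: n_def trans_le_add2)
  then have "x [^] n \<otimes> x [^] n = x [^] n"
    using shifts[of n "Suc i"] assms(2) by (simp add: nat_pow_mult n_def)
  then have "x [^] n \<in> idempotents G"
    using assms(2) by (simp add: idempotents_def)
  moreover have "0 < n" using d by (simp add: n_def)
  ultimately show thesis using that by blast
qed

lemma idempotent_product_closed: "idempotent_product G \<in> carrier G"
  unfolding idempotent_product_def by (rule finprod_closed) (auto simp: idempotents_def)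

text \<open>Some positive power of \<open>x\<close> is idempotent, hence a factor of the product,
  and \<open>x\<close> divides that power.\<close>

lemma divides_idempotent_product:
  assumes "finite (carrier G)" "x \<in> carrier G"
  shows "x divides idempotent_product G"
proof -
  obtain n :: nat where n: "0 < n" and e: "x [^] n \<in> idempotents G"
    using ex_idempotent_pow assms by blast
  define I where "I = idempotents G - {x [^] n}"
  have I: "(\<lambda>e. e) \<in> I \<rightarrow> carrier G" "finite I"
    using assms(1) by (auto simp: I_def idempotents_def)
  have "idempotent_product G = (\<Otimes>e\<in>insert (x [^] n) I. e)"
    using e by (simp add: idempotent_product_def I_def insert_absorb)
  also have "\<dots> = x [^] n \<otimes> (\<Otimes>e\<in>I. e)"
    using I assms(2) by (intro finprod_insert) (auto simp: I_def)
  also have "x [^] n = x \<otimes> x [^] (n - 1)"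
    using n assms(2) by (metis Suc_diff_1 nat_pow_Suc2)
  finally have "idempotent_product G = x \<otimes> (x [^] (n - 1) \<otimes> (\<Otimes>e\<in>I. e))"
    using I assms(2) by (simp add: m_assoc)
  then show ?thesis
    using I assms(2) by (auto simp: factor_def)
qed

text \<open>The kernel is thus the principal ideal generated by the idempotent product, since every
  element divides the latter.\<close>

lemma mem_monoid_kernel_iff:
  assumes "finite (carrier G)"
  shows "x \<in> monoid_kernel G \<longleftrightarrow> x \<in> carrier G \<and> idempotent_product G divides x"
  using divides_idempotent_product[OF assms] by (auto simp: monoid_kernel_def)

lemma monoid_kernel_mult_closed:
  assumes "finite (carrier G)" "x \<in> monoid_kernel G" "y \<in> carrier G"
  shows "x \<otimes> y \<in> monoid_kernel G"
  using assms idempotent_product_closed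
  by (auto simp: mem_monoid_kernel_iff intro: divides_prod_r)

lemma is_identity_of_monoid_kernel_unique:
  assumes "finite (carrier G)" "is_identity_of G (monoid_kernel G) z"
  shows "z = idempotent_product G"
  using assms is_identity_of_idempotent_product[OF comm_monoid_axioms]
  unfolding is_identity_of_def by metis

end

section \<open>Regular faithful quotients\<close>

lemma misere_outcome_eq_P_iff:
  "misere_outcome G = P_outcome \<longleftrightarrow>
     options G \<noteq> {||} \<and> (\<forall>G'. G' |\<in>| options G \<longrightarrow> misere_outcome G' \<noteq> P_outcome)"
  by (cases G) (auto simp: image_iff)

theorem theorem6p4:
  fixes A :: "game set" and z :: "game set"
  assumes "closed_games A"
    and "finite (carrier (quotient_monoid A))"
    and "regular_quotient A"
    and "faithful A"
    and "is_identity_of (quotient_monoid A) (monoid_kernel (quotient_monoid A)) z"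
  shows "\<forall>G\<in>A. \<forall>H\<in>A.
    z \<otimes>\<^bsub>quotient_monoid A\<^esub> quotient_map A G = z \<otimes>\<^bsub>quotient_monoid A\<^esub> quotient_map A H
      \<longleftrightarrow> grundy G = grundy H"
proof -
  let ?Q = "quotient_monoid A" and ?\<Phi> = "quotient_map A"
  let ?K = "monoid_kernel ?Q"
  have carrier: "carrier ?Q = ?\<Phi> ` A"
    by (auto simp: quotient_monoid_def quotient_def quotient_map_def)
  obtain p where p: "?K \<inter> P_portion A = {p}"
    using assms(3) by (auto simp: regular_quotient_def card_1_singleton_iff)
  then have pK: "p \<in> ?K" and "p \<in> P_portion A"
    by auto
  then obtain P where P: "P \<in> A" "?\<Phi> P = p" "misere_outcome P = P_outcome"
    by (auto simp: P_portion_def)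
  interpret comm_monoid ?Q
    using P(1) by (intro comm_monoid_quotient_monoid assms(1)) auto
  note Phi_plus = quotient_map_plus[OF assms(1)]
  have plus: "G + H \<in> A" if "G \<in> A" "H \<in> A" for G H
    using assms(1) that by (auto simp: closed_games_def)
  have option: "G' \<in> A" if "G \<in> A" "G' |\<in>| options G" for G G'
    using assms(1) that by (auto simp: closed_games_def)
  have grundy_cong: "grundy G = grundy H" if "G \<in> A" "H \<in> A" "?\<Phi> G = ?\<Phi> H" for G H
    using assms(4) that unfolding faithful_def by blast
  have z: "z = idempotent_product ?Q"
    using is_identity_of_monoid_kernel_unique assms(2,5) by blast
  have zK: "z \<in> ?K" and "\<forall>x\<in>?K. z \<otimes>\<^bsub>?Q\<^esub> x = x"
    using assms(5) by (auto simp: is_identity_of_def)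
  then have z_mult: "z \<otimes>\<^bsub>?Q\<^esub> x = x" if "x \<in> ?K" for x
    using that by blast
  \<comment> \<open>Every class, inside the kernel or not, divides \<open>z\<close>; so
    \<open>U\<close> acts as an inverse of \<open>G\<close> on the kernel.\<close>
  have inverse: "\<exists>U\<in>A. ?\<Phi> (G + U) = z" if "G \<in> A" for G
  proof -
    have "?\<Phi> G divides\<^bsub>?Q\<^esub> z"
      unfolding z using assms(2) that by (intro divides_idempotent_product) (auto simp: carrier)
    then show ?thesis using that by (auto simp: factor_def carrier Phi_plus)
  qed
  have ideal: "?\<Phi> (G + H) \<in> ?K" if "G \<in> A" "H \<in> A" "?\<Phi> G \<in> ?K" for G H
    using monoid_kernel_mult_closed[OF assms(2) that(3), of "?\<Phi> H"] that
    by (simp add: Phi_plus carrier)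
  \<comment> \<open>\<open>Z\<close> is built on \<open>P\<close> because it must have an option, which \<open>0\<close> (a possible
    representative of \<open>z\<close>) does not.\<close>
  obtain U where U: "U \<in> A" "?\<Phi> (P + U) = z"
    using inverse P(1) by blast
  define Z where "Z = P + U"
  have Z: "Z \<in> A" "?\<Phi> Z = z"
    unfolding Z_def using P(1) U by (simp_all add: plus)
  have "options P \<noteq> {||}"
    using P(3) misere_outcome_eq_P_iff[of P] by blast
  then have Z_option: "options Z \<noteq> {||}"
    by (simp add: Z_def options_plus)
  have Phi_Z_plus: "?\<Phi> (Z + G) = ?\<Phi> G" if "G \<in> A" "?\<Phi> G \<in> ?K" for G
    using that Z z_mult[OF that(2)] by (simp flip: Phi_plus)
  have eq_p: "?\<Phi> G = p" if G: "G \<in> A" "?\<Phi> G \<in> ?K" and grundy: "grundy G = grundy P" for G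
  proof (rule ccontr)
    assume neq: "?\<Phi> G \<noteq> p"
    \<comment> \<open>With two copies of \<open>Z\<close>, any single move leaves one intact, so all
      options have classes in the kernel; the class of \<open>G\<close> is unchanged.\<close>
    define X where "X = Z + (Z + G)"
    have X: "X \<in> A" "?\<Phi> X = ?\<Phi> G"
      using G Z by (simp_all add: X_def plus Phi_Z_plus)
    have "misere_outcome X \<noteq> P_outcome"
    proof
      assume "misere_outcome X = P_outcome"
      then have "?\<Phi> X \<in> ?K \<inter> P_portion A"
        using X G(2) by (auto simp: P_portion_def)
      then show False using X neq p by simp
    qed
    moreover have "options X \<noteq> {||}"
      using Z_option by (simp add: X_def options_plus)
    ultimately obtain X' where X': "X' |\<in>| options X" "misere_outcome X' = P_outcome"
      using misere_outcome_eq_P_iff[of X] by blast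
    have "X' \<in> A" using option X X' by blast
    have "?\<Phi> X' \<in> ?K"
    proof -
      consider (1) Z' where "Z' |\<in>| options Z" "X' = Z' + (Z + G)"
        | (2) Y where "Y |\<in>| options (Z + G)" "X' = Z + Y"
        using X'(1) unfolding X_def option_plus_iff by blast
      then show ?thesis
      proof cases
        case 1
        then have "X' = Z + (Z' + G)" "Z' \<in> A"
          using option Z by (auto simp: ac_simps)
        then show ?thesis using ideal[of Z "Z' + G"] Z zK G(1) by (simp add: plus)
      next
        case 2
        then show ?thesis using ideal[of Z Y] Z zK option[of "Z + G" Y] G(1) by (simp add: plus)
      qed
    qed
    then have "?\<Phi> X' \<in> ?K \<inter> P_portion A"
      using X' \<open>X' \<in> A\<close> by (auto simp: P_portion_def)
    then have "?\<Phi> X' = ?\<Phi> P" using p P(2) by simp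
    then have "grundy X' = grundy P"
      using grundy_cong \<open>X' \<in> A\<close> P(1) by blast
    moreover have "grundy X = grundy G"
      using grundy_cong X G(1) by blast
    ultimately show False
      using grundy_option_neq[OF X'(1)] grundy by simp
  qed
  have inj: "?\<Phi> G = ?\<Phi> H"
    if G: "G \<in> A" "?\<Phi> G \<in> ?K" and H: "H \<in> A" "?\<Phi> H \<in> ?K" and grundy: "grundy G = grundy H"
    for G H
  proof -
    obtain V where V: "V \<in> A" "?\<Phi> (H + V) = z"
      using inverse H(1) by blast
    \<comment> \<open>Adding \<open>W\<close> translates the class of \<open>H\<close> to
      \<open>p\<close>. Values stay equal under translation, so \<open>eq_p\<close> applies to
      \<open>G + W\<close>.\<close>
    define W where "W = V + P"
    have W: "W \<in> A" using V P(1) by (simp add: plus W_def)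
    have "?\<Phi> (H + W) = ?\<Phi> (H + V) \<otimes>\<^bsub>?Q\<^esub> ?\<Phi> P"
      using H(1) V(1) P(1) by (simp add: plus Phi_plus W_def add.assoc)
    also have "\<dots> = p"
      using V(2) P(2) z_mult[OF pK] by simp
    finally have HW: "?\<Phi> (H + W) = p" .
    have "grundy (G + W) = grundy (H + W)"
      using grundy by (simp add: add.commute[of _ W] grundy_plus_left_cancel)
    also have "\<dots> = grundy P"
      using grundy_cong[of "H + W" P] HW P H(1) W by (simp add: plus)
    finally have GW: "?\<Phi> (G + W) = p"
      using eq_p ideal G W by (simp add: plus)
    \<comment> \<open>Adding \<open>T\<close> undoes the translation by \<open>W\<close> on the
      kernel.\<close>
    obtain T where T: "T \<in> A" "?\<Phi> (W + T) = z"
      using inverse W by blast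
    have *: "?\<Phi> (X + W) \<otimes>\<^bsub>?Q\<^esub> ?\<Phi> T = ?\<Phi> X" if "X \<in> A" "?\<Phi> X \<in> ?K" for X
    proof -
      have "?\<Phi> (X + W) \<otimes>\<^bsub>?Q\<^esub> ?\<Phi> T = ?\<Phi> (W + T) \<otimes>\<^bsub>?Q\<^esub> ?\<Phi> X"
        using that(1) W T(1) by (simp add: plus Phi_plus ac_simps)
      then show ?thesis using T(2) z_mult[OF that(2)] by simp
    qed
    show ?thesis using *[OF G] *[OF H] GW HW by simp
  qed
  \<comment> \<open>Adding \<open>Z\<close> moves any game into the kernel, where \<open>inj\<close>
    applies; its value cancels at the end.\<close>
  have mult: "z \<otimes>\<^bsub>?Q\<^esub> ?\<Phi> G = ?\<Phi> (Z + G)" if "G \<in> A" for G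
    using that Z by (simp flip: Phi_plus)
  show ?thesis
  proof (intro ballI)
    fix G H assume GH: "G \<in> A" "H \<in> A"
    have "?\<Phi> (Z + G) = ?\<Phi> (Z + H) \<longleftrightarrow> grundy (Z + G) = grundy (Z + H)"
    proof
      assume "?\<Phi> (Z + G) = ?\<Phi> (Z + H)"
      then show "grundy (Z + G) = grundy (Z + H)"
        using grundy_cong GH Z plus by blast
    next
      assume "grundy (Z + G) = grundy (Z + H)"
      then show "?\<Phi> (Z + G) = ?\<Phi> (Z + H)"
        using inj[of "Z + G" "Z + H"] ideal[of Z] GH Z zK by (simp add: plus)
    qed
    then show "z \<otimes>\<^bsub>?Q\<^esub> ?\<Phi> G = z \<otimes>\<^bsub>?Q\<^esub> ?\<Phi> H \<longleftrightarrow> grundy G = grundy H"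
      using GH by (simp add: mult grundy_plus_left_cancel)
  qed
qed

end
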